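(* Let $\mathcal{U}\subseteq\mathbb{R}^q$ be nonempty, compact and convex, $\mathsf{A}\in\mathcal{S}^n$, $\mathsf{B}\in\mathbb{R}^{q\times n}$, $\mathsf{C}\in\mathcal{S}^q$, $\mathbf{a}\in\mathbb{R}^n$, $\mathbf{c}\in\mathbb{R}^q$, $\mathcal{X}\subseteq\mathbb{R}^n$, and let $\mathcal{C}\subseteq\mathcal{S}^{n+q+1}$ be closed and convex with $\mathcal{S}^{n+q+1}_+\supseteq\mathcal{C}\supseteq\mathcal{G}(\mathcal{U}\times\mathcal{X})$. Let $\mathcal{A}:\mathcal{S}^n\times\mathbb{R}^n\to\mathbb{R}^m$ be linear, $\mathcal{A}(\mathsf{X},\mathbf{x})=\mathcal{A}_X(\mathsf{X})+\mathcal{A}_x(\mathbf{x})$ with $\mathcal{A}_X,\mathcal{A}_x$ linear with adjoints $\mathcal{A}_X^*,\mathcal{A}_x^*$, and let $\mathbf{b}\in\mathbb{R}^m$ be such that $$\left\{\begin{bmatrix}1&\mathbf{x}^{\mathsf T}\\ \mathbf{x}&\mathsf{X}\end{bmatrix}\in\mathcal{S}^{n+1}_+:\mathcal{A}(\mathsf{X},\mathbf{x})=\mathbf{b}\right\}\supseteq\mathcal{G}(\mathcal{X}),\qquad \{\mathsf{X}\in\mathcal{S}^n_+:\mathcal{A}(\mathsf{X},\mathbf{0})=\mathbf{0}\}=\{\mathsf{O}\}.$$ Let $\mathcal{G}_{\mathcal{U}}=\mathcal{G}(\mathcal{U})$ or, if $\mathsf{C}=\mathsf{O}$, let $\mathcal{G}_{\mathcal{U}}\supseteq\mathcal{G}(\mathcal{U})$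 be any compact convex subset of $\mathcal{S}^{q+1}$ such that $\begin{bmatrix}1&\mathbf{u}^{\mathsf T}\\ \mathbf{u}&\mathsf{U}\end{bmatrix}\in\mathcal{G}_{\mathcal{U}}$ implies $\mathbf{u}\in\mathcal{U}$. Define, for $\mathbf{x}\in\mathbb{R}^n$, $$g(\mathbf{x})=\sup_{\Psi,\mathbf{u},\mathsf{U},\mathsf{X}}\left\{\begin{array}{l}\mathsf{A}\bullet\mathsf{X}+2\mathbf{a}^{\mathsf T}\mathbf{x}+2\mathsf{B}^{\mathsf T}\bullet\Psi+\mathsf{C}\bullet\mathsf{U}+2\mathbf{c}^{\mathsf T}\mathbf{u}\ :\\[2pt] \begin{bmatrix}1&\mathbf{u}^{\mathsf T}&\mathbf{x}^{\mathsf T}\\ \mathbf{u}&\mathsf{U}&\Psi^{\mathsf T}\\ \mathbf{x}&\Psi&\mathsf{X}\end{bmatrix}\in\mathcal{C},\ \begin{bmatrix}1&\mathbf{u}^{\mathsf T}\\ \mathbf{u}&\mathsf{U}\end{bmatrix}\in\mathcal{G}_{\mathcal{U}},\ \mathcal{A}(\mathsf{X},\mathbf{x})=\mathbf{b}\end{array}\right\}$$ with $\Psi\in\mathbb{R}^{n\times q}$, $\mathbf{u}\in\mathbb{R}^q$, $\mathsf{U}\in\mathcal{S}^q$, $\mathsf{X}\in\mathcal{S}^n$. Let $\bar{\mathbf{x}}\in\operatorname{dom}(g)$ and let $(\mathbf{w},\alpha,\boldsymbol{\lambda})\in\mathbb{R}^n\times\mathbb{R}\times\mathbb{R}^m$ be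 feasible for the dual problem of $g(\bar{\mathbf{x}})$, i.e. $$\begin{bmatrix}\alpha&-\mathbf{c}^{\mathsf T}&\mathbf{w}^{\mathsf T}\\ -\mathbf{c}&-\mathsf{C}&-\mathsf{B}\\ \mathbf{w}&-\mathsf{B}^{\mathsf T}&\mathcal{A}_X^*(\boldsymbol{\lambda})-\mathsf{A}\end{bmatrix}\in\bar{\mathcal{C}}^*,$$ whose dual objective value at $\bar{\mathbf{x}}$ is $\alpha+\mathbf{b}^{\mathsf T}\boldsymbol{\lambda}+(2\mathbf{a}+2\mathbf{w}-\mathcal{A}_x^*(\boldsymbol{\lambda}))^{\mathsf T}\bar{\mathbf{x}}$. Then $$\bar{\mathbf{y}}:=2\mathbf{a}+2\mathbf{w}-\mathcal{A}_x^*(\boldsymbol{\lambda})\in\partial_\epsilon g(\bar{\mathbf{x}})\qquad\text{with}\qquad \epsilon=\alpha+\mathbf{b}^{\mathsf T}\boldsymbol{\lambda}+\bar{\mathbf{x}}^{\mathsf T}\bar{\mathbf{y}}-g(\bar{\mathbf{x}})\ge 0.$$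
   Context: $\mathcal{S}^d$ is the space of symmetric $d\times d$ matrices, $\mathcal{S}^d_+$ the cone of positive semidefinite ones, $\mathsf{O}$ the zero matrix, $\mathsf{M}\bullet\mathsf{N}=\operatorname{Tr}(\mathsf{M}^{\mathsf T}\mathsf{N})$. For $\mathcal{F}\subseteq\mathbb{R}^d$, $\mathcal{G}(\mathcal{F})\subseteq\mathcal{S}^{d+1}$ is the closure of the convex hull of $\left\{\begin{bmatrix}1\\ \mathbf{y}\end{bmatrix}\begin{bmatrix}1\\ \mathbf{y}\end{bmatrix}^{\mathsf T}:\mathbf{y}\in\mathcal{F}\right\}$; elements of $\mathcal{U}\times\mathcal{X}$ are vectors $(\mathbf{u}^{\mathsf T},\mathbf{x}^{\mathsf T})^{\mathsf T}\in\mathbb{R}^{q+n}$. For a set $\mathcal{M}$, $\operatorname{cone}(\mathcal{M})$ is the union of its conic hull and the origin. Define $$\bar{\mathcal{C}}=\left\{\begin{bmatrix}x_0&\mathbf{u}^{\mathsf T}&\mathbf{x}^{\mathsf T}\\ \mathbf{u}&\mathsf{U}&\Psi^{\mathsf T}\\ \mathbf{x}&\Psi&\mathsf{X}\end{bmatrix}\in\operatorname{cone}(\mathcal{C}):\begin{bmatrix}x_0&\mathbf{u}^{\mathsf T}\\ \mathbf{u}&\mathsf{U}\end{bmatrix}\in\operatorname{cone}(\mathcal{G}_{\mathcal{U}})\right\}\subseteq\mathcal{S}^{n+q+1}_+,$$ and $\bar{\mathcal{C}}^*=\{\mathsf{M}\in\mathcal{S}^{n+q+1}:\mathsf{M}\bullet\mathsf{Y}\ge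 0\ \ \forall\,\mathsf{Y}\in\bar{\mathcal{C}}\}$. Convention: $\sup\emptyset=-\infty$. For a concave function $g$, $\operatorname{dom}(g)=\{\mathbf{x}:g(\mathbf{x})>-\infty\}$, and the set of $\epsilon$-supergradients of $g$ at $\bar{\mathbf{x}}$ is $\partial_\epsilon g(\bar{\mathbf{x}})=\{\mathbf{y}\in\mathbb{R}^n:g(\mathbf{x})\le g(\bar{\mathbf{x}})+\mathbf{y}^{\mathsf T}(\mathbf{x}-\bar{\mathbf{x}})+\epsilon\ \ \forall\,\mathbf{x}\in\mathbb{R}^n\}$. *)

theory Defs
  imports "HOL-Analysis.Analysis"
begin

definition sym_mats :: "(real^'d^'d) set" where
  "sym_mats = {M. transpose M = M}"

definition psd_mats :: "(real^'d^'d) set" where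
  "psd_mats = {M \<in> sym_mats. \<forall>v. 0 \<le> v \<bullet> (M *v v)}"

definition frob :: "real^'n^'m \<Rightarrow> real^'n^'m \<Rightarrow> real"  (infixl "\<bullet>\<^sub>F" 70) where
  "M \<bullet>\<^sub>F N = trace (transpose M ** N)"

text \<open>
  A vector of \<open>\<real>\<^sup>p\<^sup>+\<^sup>d\<close> is indexed by the sum type of the two index types, so that
  matrices of order \<open>n + q + 1\<close> have index type \<^typ>\<open>1 + 'q + 'n\<close>, associated to the right.
  As usual, \<^typ>\<open>real^'q^'n\<close> is the type of matrices with rows indexed by \<^typ>\<open>'n\<close>
  and columns indexed by \<^typ>\<open>'q\<close>.
\<close>

definition vec_join :: "real^'p \<Rightarrow> real^'d \<Rightarrow> real^('p + 'd)" where
  "vec_join u x = (\<chi> i. case i of Inl k \<Rightarrow> u $ k | Inr k \<Rightarrow> x $ k)"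

definition mat_join ::
  "real^'p^'p \<Rightarrow> real^'d^'p \<Rightarrow> real^'p^'d \<Rightarrow> real^'d^'d \<Rightarrow> real^('p + 'd)^('p + 'd)" where
  "mat_join P Q R S = (\<chi> i j. case i of
      Inl k \<Rightarrow> (case j of Inl l \<Rightarrow> P $ k $ l | Inr l \<Rightarrow> Q $ k $ l)
    | Inr k \<Rightarrow> (case j of Inl l \<Rightarrow> R $ k $ l | Inr l \<Rightarrow> S $ k $ l))"

text \<open>The matrix with first row \<open>(t, v\<^sup>T)\<close>, first column \<open>(t, v)\<close> and remaining block \<open>M\<close>.\<close>

definition bordered :: "real \<Rightarrow> real^'d \<Rightarrow> real^'d^'d \<Rightarrow> real^(1 + 'd)^(1 + 'd)" where
  "bordered t v M = mat_join (mat t) (rowvector v) (columnvector v) M"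

text \<open>The block matrix with rows \<open>(t, u\<^sup>T, x\<^sup>T)\<close>, \<open>(u, U, \<Psi>\<^sup>T)\<close> and \<open>(x, \<Psi>, X)\<close>.\<close>

definition block3 ::
  "real \<Rightarrow> real^'q \<Rightarrow> real^'n \<Rightarrow> real^'q^'q \<Rightarrow> real^'q^'n \<Rightarrow> real^'n^'n
    \<Rightarrow> real^(1 + 'q + 'n)^(1 + 'q + 'n)" where
  "block3 t u x U \<Psi> X = bordered t (vec_join u x) (mat_join U (transpose \<Psi>) \<Psi> X)"

definition vec_prod :: "(real^'q) set \<Rightarrow> (real^'n) set \<Rightarrow> (real^('q + 'n)) set" where
  "vec_prod \<U> \<X> = {vec_join u x | u x. u \<in> \<U> \<and> x \<in> \<X>}"

definition one_join :: "real^'d \<Rightarrow> real^(1 + 'd)" where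
  "one_join y = vec_join (vec 1) y"

definition outer :: "real^'d \<Rightarrow> real^'d^'d" where
  "outer v = (\<chi> i j. v $ i * v $ j)"

definition \<G> :: "(real^'d) set \<Rightarrow> (real^(1 + 'd)^(1 + 'd)) set" where
  "\<G> F = closure (convex hull ((\<lambda>y. outer (one_join y)) ` F))"

text \<open>The origin has to be added only for the empty set, as \<open>conic hull {} = {}\<close>.\<close>

definition cone_of :: "'a::real_vector set \<Rightarrow> 'a set" where
  "cone_of S = insert 0 (conic hull S)"

definition C_bar ::
  "(real^(1 + 'q::finite + 'n::finite)^(1 + 'q + 'n)) set \<Rightarrow> (real^(1 + 'q)^(1 + 'q)) set
    \<Rightarrow> (real^(1 + 'q + 'n)^(1 + 'q + 'n)) set" where
  "C_bar \<C> \<G>U = {block3 t u x U \<Psi> X | t u x U \<Psi> X.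
     block3 t u x U \<Psi> X \<in> cone_of \<C> \<and> bordered t u U \<in> cone_of \<G>U}"

definition dual_cone :: "(real^'d^'d) set \<Rightarrow> (real^'d^'d) set" where
  "dual_cone K = {M \<in> sym_mats. \<forall>Y \<in> K. 0 \<le> M \<bullet>\<^sub>F Y}"

definition linear_on :: "'a::real_vector set \<Rightarrow> ('a \<Rightarrow> 'b::real_vector) \<Rightarrow> bool" where
  "linear_on S f \<longleftrightarrow>
     (\<forall>x \<in> S. \<forall>y \<in> S. f (x + y) = f x + f y) \<and> (\<forall>r. \<forall>x \<in> S. f (r *\<^sub>R x) = r *\<^sub>R f x)"

text \<open>
  The adjoint of a linear map whose domain is the space of symmetric matrices takes values in that
  space, so it is not the library's \<^const>\<open>adjoint\<close> of an extension to all square matrices.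
\<close>

definition sym_adjoint :: "(real^'n^'n \<Rightarrow> real^'m) \<Rightarrow> real^'m \<Rightarrow> real^'n^'n" where
  "sym_adjoint f = (SOME f'. \<forall>l. f' l \<in> sym_mats \<and> (\<forall>X \<in> sym_mats. f X \<bullet> l = X \<bullet>\<^sub>F f' l))"

lemma frob_eq_inner: "M \<bullet>\<^sub>F N = M \<bullet> N"
  unfolding frob_def trace_def matrix_matrix_mult_def transpose_def inner_vec_def
  by (simp, rule sum.swap)

lemma sym_adjoint_works:
  fixes f :: "real^'n^'n \<Rightarrow> real^'m"
  assumes f: "linear_on sym_mats f"
  shows "sym_adjoint f l \<in> sym_mats"
    and "X \<in> sym_mats \<Longrightarrow> f X \<bullet> l = X \<bullet>\<^sub>F sym_adjoint f l"
proof -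
  define s :: "real^'n^'n \<Rightarrow> real^'n^'n" where "s M = (1/2) *\<^sub>R (M + transpose M)" for M
  have s_sym: "s M \<in> sym_mats" for M
    by (simp add: s_def sym_mats_def transpose_def vec_eq_iff)
  have s_id: "s M = M" if "M \<in> sym_mats" for M
    using that by (simp add: s_def sym_mats_def vec_eq_iff)
  have s_add: "s (M + N) = s M + s N" and s_scale: "s (r *\<^sub>R M) = r *\<^sub>R s M" for M N r
    by (simp_all add: s_def transpose_def vec_eq_iff algebra_simps)
  have lin: "linear (\<lambda>M. f (s M))"
    using f s_sym by (intro linearI) (auto simp: linear_on_def s_add s_scale)
  have inner_s: "X \<bullet> s M = X \<bullet> M" if "X \<in> sym_mats" for X M
  proof -
    have X: "X $ i $ j = X $ j $ i" for i j
      using that by (auto simp: sym_mats_def transpose_def vec_eq_iff)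
    have "X \<bullet> transpose M = (\<Sum>i\<in>UNIV. \<Sum>j\<in>UNIV. X $ j $ i * M $ j $ i)"
      unfolding inner_vec_def transpose_def
      by (auto intro!: sum.cong simp: X[symmetric])
    also have "\<dots> = X \<bullet> M"
      unfolding inner_vec_def by (subst sum.swap) simp
    finally show ?thesis
      by (simp add: s_def inner_add_right)
  qed
  have "\<exists>f'. \<forall>l. f' l \<in> sym_mats \<and> (\<forall>X \<in> sym_mats. f X \<bullet> l = X \<bullet>\<^sub>F f' l)"
  proof (intro exI allI conjI ballI)
    fix l X
    show "s (adjoint (\<lambda>M. f (s M)) l) \<in> sym_mats"
      by (rule s_sym)
    show "f X \<bullet> l = X \<bullet>\<^sub>F s (adjoint (\<lambda>M. f (s M)) l)" if "X \<in> sym_mats"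
      using adjoint_works[OF lin, of X l] that
      by (simp add: frob_eq_inner inner_s s_id)
  qed
  from someI_ex[OF this]
  show "sym_adjoint f l \<in> sym_mats"
    and "X \<in> sym_mats \<Longrightarrow> f X \<bullet> l = X \<bullet>\<^sub>F sym_adjoint f l"
    unfolding sym_adjoint_def by blast+
qed

definition g_fun ::
  "real^'n^'n \<Rightarrow> real^'n^'q \<Rightarrow> real^'q^'q \<Rightarrow> real^'n \<Rightarrow> real^'q
    \<Rightarrow> (real^(1 + 'q + 'n)^(1 + 'q + 'n)) set \<Rightarrow> (real^(1 + 'q)^(1 + 'q)) set
    \<Rightarrow> ((real^'n^'n) \<times> (real^'n) \<Rightarrow> real^'m) \<Rightarrow> real^'m \<Rightarrow> real^'n \<Rightarrow> ereal" where
  "g_fun A B C a c \<C> \<G>U \<A> b x = Sup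
     {ereal (A \<bullet>\<^sub>F X + 2 * (a \<bullet> x) + 2 * (transpose B \<bullet>\<^sub>F \<Psi>) + C \<bullet>\<^sub>F U + 2 * (c \<bullet> u)) | \<Psi> u U X.
        U \<in> sym_mats \<and> X \<in> sym_mats \<and>
        block3 1 u x U \<Psi> X \<in> \<C> \<and> bordered 1 u U \<in> \<G>U \<and> \<A> (X, x) = b}"

definition eff_dom :: "('a \<Rightarrow> ereal) \<Rightarrow> 'a set" where
  "eff_dom g = {x. g x > -\<infinity>}"

definition eps_supergradients :: "real \<Rightarrow> ('a::real_inner \<Rightarrow> ereal) \<Rightarrow> 'a \<Rightarrow> 'a set" where
  "eps_supergradients \<epsilon> g z = {y. \<forall>x. g x \<le> g z + ereal (y \<bullet> (x - z)) + ereal \<epsilon>}"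

definition dual_feasible ::
  "real^'n^'n \<Rightarrow> real^'n^'q \<Rightarrow> real^'q^'q \<Rightarrow> real^'q
    \<Rightarrow> (real^(1 + 'q + 'n)^(1 + 'q + 'n)) set \<Rightarrow> (real^(1 + 'q)^(1 + 'q)) set
    \<Rightarrow> (real^'n^'n \<Rightarrow> real^'m) \<Rightarrow> real^'n \<Rightarrow> real \<Rightarrow> real^'m \<Rightarrow> bool" where
  "dual_feasible A B C c \<C> \<G>U \<A>\<^sub>X w \<alpha> l \<longleftrightarrow>
     bordered \<alpha> (vec_join (- c) w)
       (mat_join (- C) (- B) (- transpose B) (sym_adjoint \<A>\<^sub>X l - A)) \<in> dual_cone (C_bar \<C> \<G>U)"

end

theory Submission
  imports Defs
begin

text \<open>
  The theorem is weak duality applied simultaneously at every point. The feasibility condition on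
  \<open>(w, \<alpha>, lam)\<close> does not mention the point at which \<open>g\<close> is evaluated: if
  \<open>(\<Psi>, u, U, X)\<close> is feasible for the supremum defining \<open>g x\<close>, then its block matrix lies in
  \<^term>\<open>C_bar \<C> \<G>U\<close>, so its Frobenius product with the dual matrix is nonnegative. Expanding this
  product by blocks (\<open>inner_bordered\<close>, \<open>inner_vec_join\<close>, \<open>inner_mat_join\<close>) and eliminating \<open>X\<close> from
  the multiplier term through the constraint \<open>\<A> (X, x) = b\<close> and the adjoints bounds the primal
  objective at \<open>(\<Psi>, u, U, X)\<close> by \<open>\<alpha> + b \<bullet> lam + x \<bullet> ybar\<close>.

  Hence this affine function of \<open>x\<close> is a majorant of \<open>g\<close> on the whole space
  (\<open>g_fun_le_dual_value\<close>), with slope \<open>ybar\<close>. The slope of an affine majorant whose gap to \<open>g\<close> at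
  \<open>xbar\<close> is \<open>\<epsilon>\<close> is an \<open>\<epsilon>\<close>-supergradient at \<open>xbar\<close>, and the gap is nonnegative
  (\<open>affine_majorant_imp_eps_supergradient\<close>).
\<close>

lemma sum_UNIV_sum_type:
  "(\<Sum>i\<in>UNIV. f i) = (\<Sum>k\<in>UNIV. f (Inl k)) + (\<Sum>k\<in>UNIV. f (Inr k))"
  for f :: "'p::finite + 'd::finite \<Rightarrow> 'a::comm_monoid_add"
  by (simp add: UNIV_Plus_UNIV[symmetric] sum.Plus del: UNIV_Plus_UNIV)

lemma inner_vec_join: "vec_join u x \<bullet> vec_join u' x' = u \<bullet> u' + x \<bullet> x'"
  by (simp add: inner_vec_def vec_join_def sum_UNIV_sum_type)

lemma inner_mat_join:
  "mat_join P Q R S \<bullet> mat_join P' Q' R' S' = P \<bullet> P' + Q \<bullet> Q' + R \<bullet> R' + S \<bullet> S'"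
  by (simp add: inner_vec_def mat_join_def sum_UNIV_sum_type sum.distrib)

lemma inner_bordered: "bordered t v M \<bullet> bordered t' v' M' = t * t' + 2 * (v \<bullet> v') + M \<bullet> M'"
proof -
  have "(mat t :: real^1^1) \<bullet> mat t' = t * t'"
    by (simp add: inner_vec_def mat_def)
  moreover have "(rowvector v :: real^_^1) \<bullet> rowvector v' = v \<bullet> v'"
    by (simp add: inner_vec_def rowvector_def)
  moreover have "(columnvector v :: real^1^_) \<bullet> columnvector v' = v \<bullet> v'"
    by (simp add: inner_vec_def columnvector_def)
  ultimately show ?thesis
    by (simp add: bordered_def inner_mat_join)
qed

lemma inner_transpose: "transpose M \<bullet> transpose N = M \<bullet> N"
  for M N :: "real^'n^'m"
  unfolding inner_vec_def transpose_def by (simp, rule sum.swap)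

lemma subset_cone_of: "S \<subseteq> cone_of S"
  unfolding cone_of_def using hull_subset[of S conic] by blast

text \<open>
  Weak duality at an arbitrary point \<open>x\<close>. Since symmetry of \<open>X\<close> is part of primal feasibility, the
  adjoint identity for \<open>\<A>\<^sub>X\<close> applies to it, and the constraint turns \<open>\<A>\<^sub>X X \<bullet> lam\<close> into an affine
  function of \<open>x\<close> alone; this is where the term \<open>- adjoint \<A>\<^sub>x lam\<close> of the slope comes from.
\<close>

lemma g_fun_le_dual_value:
  fixes A :: "real^'n^'n" and B :: "real^'n^'q" and \<A>\<^sub>X :: "real^'n^'n \<Rightarrow> real^'m"
  assumes lin: "linear_on sym_mats \<A>\<^sub>X" "linear \<A>\<^sub>x"
    and split: "\<And>X x. X \<in> sym_mats \<Longrightarrow> \<A> (X, x) = \<A>\<^sub>X X + \<A>\<^sub>x x"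
    and feas: "dual_feasible A B C c \<C> \<G>U \<A>\<^sub>X w \<alpha> lam"
  shows "g_fun A B C a c \<C> \<G>U \<A> b x
    \<le> ereal (\<alpha> + b \<bullet> lam + x \<bullet> (2 *\<^sub>R a + 2 *\<^sub>R w - adjoint \<A>\<^sub>x lam))"
proof -
  have bound: "A \<bullet>\<^sub>F X + 2 * (a \<bullet> x) + 2 * (transpose B \<bullet>\<^sub>F \<Psi>) + C \<bullet>\<^sub>F U + 2 * (c \<bullet> u)
      \<le> \<alpha> + b \<bullet> lam + x \<bullet> (2 *\<^sub>R a + 2 *\<^sub>R w - adjoint \<A>\<^sub>x lam)"
    if X: "X \<in> sym_mats" and Y: "block3 1 u x U \<Psi> X \<in> \<C>"
      and GU: "bordered 1 u U \<in> \<G>U" and b: "\<A> (X, x) = b" for \<Psi> u U X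
  proof -
    have "block3 1 u x U \<Psi> X \<in> cone_of \<C>" "bordered 1 u U \<in> cone_of \<G>U"
      by (rule subsetD[OF subset_cone_of], fact)+
    then have "block3 1 u x U \<Psi> X \<in> C_bar \<C> \<G>U"
      unfolding C_bar_def by (intro CollectI exI conjI) (rule refl)
    then have "0 \<le> bordered \<alpha> (vec_join (- c) w)
        (mat_join (- C) (- B) (- transpose B) (sym_adjoint \<A>\<^sub>X lam - A)) \<bullet> block3 1 u x U \<Psi> X"
      using feas by (simp add: dual_feasible_def dual_cone_def frob_eq_inner)
    moreover have "B \<bullet> transpose \<Psi> = transpose B \<bullet> \<Psi>"
      using inner_transpose[of B "transpose \<Psi>"] by simp
    ultimately have "0 \<le> \<alpha> - 2 * (c \<bullet> u) + 2 * (w \<bullet> x) - C \<bullet> U - 2 * (transpose B \<bullet> \<Psi>)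
        + sym_adjoint \<A>\<^sub>X lam \<bullet> X - A \<bullet> X"
      by (simp add: block3_def inner_bordered inner_vec_join inner_mat_join inner_diff_left)
    moreover have "sym_adjoint \<A>\<^sub>X lam \<bullet> X = b \<bullet> lam - x \<bullet> adjoint \<A>\<^sub>x lam"
    proof -
      have "sym_adjoint \<A>\<^sub>X lam \<bullet> X = \<A>\<^sub>X X \<bullet> lam"
        using sym_adjoint_works(2)[OF lin(1) X] by (simp add: frob_eq_inner inner_commute)
      also have "\<dots> = (b - \<A>\<^sub>x x) \<bullet> lam"
        using split[OF X, of x] b by simp
      also have "\<dots> = b \<bullet> lam - x \<bullet> adjoint \<A>\<^sub>x lam"
        by (simp add: inner_diff_left adjoint_works[OF lin(2)])
      finally show ?thesis .
    qed
    ultimately show ?thesis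
      by (simp add: frob_eq_inner inner_diff_right inner_add_right inner_commute)
  qed
  show ?thesis
    unfolding g_fun_def by (rule Sup_least) (use bound in auto)
qed

text \<open>
  Moving the base point of the affine majorant to \<open>z\<close> turns its constant term into
  \<open>f z\<close> plus the gap at \<open>z\<close>. The majorant keeps \<open>f z\<close> below \<open>\<infinity>\<close>, so on the
  effective domain the gap is a real number.
\<close>

lemma affine_majorant_imp_eps_supergradient:
  assumes maj: "\<And>x. f x \<le> ereal (\<beta> + x \<bullet> y)" and z: "z \<in> eff_dom f"
  shows "\<exists>\<epsilon>::real. ereal \<epsilon> = ereal (\<beta> + z \<bullet> y) - f z \<and> \<epsilon> \<ge> 0 \<and> y \<in> eps_supergradients \<epsilon> f z"
proof -
  obtain r where r: "f z = ereal r"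
    using maj[of z] z by (cases "f z") (auto simp: eff_dom_def)
  have "f x \<le> f z + ereal (y \<bullet> (x - z)) + ereal (\<beta> + z \<bullet> y - r)" for x
    using maj[of x] by (simp add: r inner_diff_right inner_commute add.commute)
  then show ?thesis
    using maj[of z] r by (intro exI[of _ "\<beta> + z \<bullet> y - r"]) (auto simp: eps_supergradients_def)
qed

theorem theorem16:
  fixes \<U> :: "(real^'q) set" and \<X> :: "(real^'n) set"
    and A :: "real^'n^'n" and B :: "real^'n^'q" and C :: "real^'q^'q"
    and a :: "real^'n" and c :: "real^'q"
    and \<C> :: "(real^(1 + 'q + 'n)^(1 + 'q + 'n)) set"
    and \<G>U :: "(real^(1 + 'q)^(1 + 'q)) set"
    and \<A> :: "(real^'n^'n) \<times> (real^'n) \<Rightarrow> real^'m"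
    and \<A>\<^sub>X :: "real^'n^'n \<Rightarrow> real^'m" and \<A>\<^sub>x :: "real^'n \<Rightarrow> real^'m"
    and b :: "real^'m"
    and xbar w :: "real^'n" and \<alpha> :: real and lam :: "real^'m"
  defines "g \<equiv> g_fun A B C a c \<C> \<G>U \<A> b"
    and "ybar \<equiv> 2 *\<^sub>R a + 2 *\<^sub>R w - adjoint \<A>\<^sub>x lam"
  assumes U: "\<U> \<noteq> {}" "compact \<U>" "convex \<U>"
    and A: "A \<in> sym_mats"
    and C: "C \<in> sym_mats"
    and CC: "closed \<C>" "convex \<C>" "\<C> \<subseteq> psd_mats" "\<G> (vec_prod \<U> \<X>) \<subseteq> \<C>"
    and lin: "linear_on (sym_mats \<times> UNIV) \<A>" "linear_on sym_mats \<A>\<^sub>X" "linear \<A>\<^sub>x"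
    and split: "\<forall>X \<in> sym_mats. \<forall>x. \<A> (X, x) = \<A>\<^sub>X X + \<A>\<^sub>x x"
    and valid: "\<G> \<X> \<subseteq> {bordered 1 x X | x X. bordered 1 x X \<in> psd_mats \<and> \<A> (X, x) = b}"
    and recession: "{X \<in> psd_mats. \<A> (X, 0) = 0} = {0}"
    and GU: "\<G>U = \<G> \<U> \<or>
      (C = 0 \<and> \<G> \<U> \<subseteq> \<G>U \<and> \<G>U \<subseteq> sym_mats \<and> compact \<G>U \<and> convex \<G>U \<and>
       (\<forall>u U. bordered 1 u U \<in> \<G>U \<longrightarrow> u \<in> \<U>))"
    and xbar: "xbar \<in> eff_dom g"
    and feas: "dual_feasible A B C c \<C> \<G>U \<A>\<^sub>X w \<alpha> lam"
  shows "\<exists>\<epsilon>::real. ereal \<epsilon> = ereal (\<alpha> + b \<bullet> lam + xbar \<bullet> ybar) - g xbar \<and>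
           \<epsilon> \<ge> 0 \<and> ybar \<in> eps_supergradients \<epsilon> g xbar"
  unfolding ybar_def
proof (rule affine_majorant_imp_eps_supergradient)
  show "g x \<le> ereal (\<alpha> + b \<bullet> lam + x \<bullet> (2 *\<^sub>R a + 2 *\<^sub>R w - adjoint \<A>\<^sub>x lam))" for x
    unfolding g_def using lin(2,3) split feas by (intro g_fun_le_dual_value) auto
qed (rule xbar)

end
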